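(* Let $0<\alpha<1$ and $\theta^2\le\varepsilon^2$. Let $0=t_0<t_1<\cdots<t_M=T$ be an arbitrary time mesh (no restriction on the mesh), with $\tau_n=t_n-t_{n-1}$. Let $(\phi^n,R^n)_{0\le n\le M}$ satisfy, for $n=0,1,\dots,M-1$, the scheme $$L_l^\alpha\phi^{n+1}-\varepsilon^2\Delta\phi^{n+1}+\Big(1-\frac{R^{n+1}}{R^n}\Big)\theta^2\Delta\phi^n+\frac{R^{n+1}}{R^n}\big(F'(\phi^n)+L_h^\alpha\phi^{n+1}\big)=0,$$ $$\frac{R^{n+1}-R^n}{\tau_{n+1}}=\frac{1}{2R^n}\Big(-\theta^2\Delta\phi^n+F'(\phi^n)+L_h^\alpha\phi^{n+1},\ \frac{\phi^{n+1}-\phi^n}{\tau_{n+1}}\Big),$$ with periodic or Neumann boundary conditions on the $\phi^n$. Then the scheme is stable in the sense that the following discrete energy dissipation law holds: $$E^{n+1}_{\varepsilon,\theta}-E^n_{\varepsilon,\theta}\le 0,\qquad n=0,1,\dots,M-1,$$ where $$E^n_{\varepsilon,\theta}:=\tfrac12(\varepsilon^2-\theta^2)\|\nabla\phi^n\|_0^2+|R^n|^2 .$$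
   Context: The scheme is a time discretization (continuous in space) of the time fractional Allen–Cahn equation ${}_0D_t^\alpha\phi=\varepsilon^2\Delta\phi-F'(\phi)$ on a bounded domain $\Omega\subset\mathbb{R}^d$, $d\in\{1,2,3\}$, with periodic boundary conditions ($\Omega$ a box) or homogeneous Neumann boundary conditions, where $F:\mathbb{R}\to\mathbb{R}$ is a (differentiable) nonlinear potential and $\varepsilon,\theta$ are real constants. $(\cdot,\cdot)$ and $\|\cdot\|_0$ denote the $L^2(\Omega)$ inner product and norm. Each $\phi^n$ is a real-valued function on $\Omega$ satisfying the boundary condition, regular enough (e.g. $\phi^n\in H^2(\Omega)$, $F'(\phi^n)\in L^2(\Omega)$) for the scheme to hold in $L^2(\Omega)$ and for Green's formula $-(\Delta u,v)=(\nabla u,\nabla v)$ to apply without boundary terms; each $R^n$ is a real number (an auxiliary scalar variable), with $R^n\ne0$ whenever it appears in a denominator. For each $n$, the discrete fractional operators (L1 approximation) are $$L_l^\alpha\phi^{n+1}=b_0\frac{\phi^{n+1}-\phi^n}{\tau_{n+1}},\qquad L_h^\alpha\phi^{n+1}=\sum_{k=0}^{n-1}b_{n-k}\frac{\phi^{k+1}-\phi^k}{\tau_{k+1}}$$ (the empty sum for $n=0$ is $0$), with coefficients, depending on $n$, $$b_{n-k}=\frac{1}{\Gamma(1-\alpha)}\int_{t_k}^{t_{k+1}}(t_{n+1}-s)^{-\alpha}\,ds,\qquad k=0,1,\dots,n .$$ *)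

theory Defs
  imports "HOL-Analysis.Analysis"
begin

section \<open>The space \<open>L\<^sup>2(\<Omega>)\<close>\<close>

definition L2 :: "'a::euclidean_space set \<Rightarrow> ('a \<Rightarrow> real) set" where
  "L2 \<Omega> = {u \<in> borel_measurable (lebesgue_on \<Omega>). integrable (lebesgue_on \<Omega>) (\<lambda>x. (u x)\<^sup>2)}"

text \<open>The inner product is used for scalar functions and for gradient fields.\<close>

definition l2_inner ::
    "'a::euclidean_space set \<Rightarrow> ('a \<Rightarrow> 'b::euclidean_space) \<Rightarrow> ('a \<Rightarrow> 'b) \<Rightarrow> real" where
  "l2_inner \<Omega> u v = integral\<^sup>L (lebesgue_on \<Omega>) (\<lambda>x. u x \<bullet> v x)"

definition l2_norm :: "'a::euclidean_space set \<Rightarrow> ('a \<Rightarrow> 'b::euclidean_space) \<Rightarrow> real" where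
  "l2_norm \<Omega> u = sqrt (l2_inner \<Omega> u u)"


section \<open>Smooth functions and test functions\<close>

definition partial :: "'a::euclidean_space \<Rightarrow> ('a \<Rightarrow> real) \<Rightarrow> 'a \<Rightarrow> real" where
  "partial i f = (\<lambda>x. frechet_derivative f (at x) i)"

primrec Ck :: "nat \<Rightarrow> ('a::euclidean_space \<Rightarrow> real) \<Rightarrow> bool" where
  "Ck 0 f \<longleftrightarrow> continuous_on UNIV f"
| "Ck (Suc k) f \<longleftrightarrow> (\<forall>x. f differentiable (at x)) \<and> (\<forall>i\<in>Basis. Ck k (partial i f))"

definition smooth :: "('a::euclidean_space \<Rightarrow> real) \<Rightarrow> bool" where
  "smooth f \<longleftrightarrow> (\<forall>k. Ck k f)"

definition test_fun :: "'a::euclidean_space set \<Rightarrow> ('a \<Rightarrow> real) \<Rightarrow> bool" where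
  "test_fun \<Omega> \<psi> \<longleftrightarrow> smooth \<psi> \<and> (\<exists>K. compact K \<and> K \<subseteq> \<Omega> \<and> (\<forall>x. x \<notin> K \<longrightarrow> \<psi> x = 0))"


section \<open>Weak derivatives and Sobolev spaces\<close>

definition has_weak_partial ::
    "'a::euclidean_space set \<Rightarrow> 'a \<Rightarrow> ('a \<Rightarrow> real) \<Rightarrow> ('a \<Rightarrow> real) \<Rightarrow> bool" where
  "has_weak_partial \<Omega> i u g \<longleftrightarrow> u \<in> L2 \<Omega> \<and> g \<in> L2 \<Omega> \<and>
     (\<forall>\<psi>. test_fun \<Omega> \<psi> \<longrightarrow> l2_inner \<Omega> u (partial i \<psi>) = - l2_inner \<Omega> g \<psi>)"

text \<open>
  On an open set the weak derivative is unique up to null sets, so the choice below only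
  selects a representative of an \<open>L\<^sup>2\<close> class.
\<close>

definition weak_partial ::
    "'a::euclidean_space set \<Rightarrow> 'a \<Rightarrow> ('a \<Rightarrow> real) \<Rightarrow> 'a \<Rightarrow> real" where
  "weak_partial \<Omega> i u = (SOME g. has_weak_partial \<Omega> i u g)"

definition weak_grad :: "'a::euclidean_space set \<Rightarrow> ('a \<Rightarrow> real) \<Rightarrow> 'a \<Rightarrow> 'a" where
  "weak_grad \<Omega> u x = (\<Sum>i\<in>Basis. weak_partial \<Omega> i u x *\<^sub>R i)"

definition weak_laplacian :: "'a::euclidean_space set \<Rightarrow> ('a \<Rightarrow> real) \<Rightarrow> 'a \<Rightarrow> real" where
  "weak_laplacian \<Omega> u x = (\<Sum>i\<in>Basis. weak_partial \<Omega> i (weak_partial \<Omega> i u) x)"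

definition H1 :: "'a::euclidean_space set \<Rightarrow> ('a \<Rightarrow> real) set" where
  "H1 \<Omega> = {u \<in> L2 \<Omega>. \<forall>i\<in>Basis. \<exists>g. has_weak_partial \<Omega> i u g}"

definition H2 :: "'a::euclidean_space set \<Rightarrow> ('a \<Rightarrow> real) set" where
  "H2 \<Omega> = {u \<in> H1 \<Omega>. \<forall>i\<in>Basis. weak_partial \<Omega> i u \<in> H1 \<Omega>}"


section \<open>Boundary conditions\<close>

text \<open>
  The homogeneous Neumann condition in its usual variational form: Green's formula holds without
  boundary term against every function of \<open>H\<^sup>1(\<Omega>)\<close>. For \<open>u \<in> H\<^sup>2(\<Omega>)\<close> on a Lipschitz domain this
  says exactly that the trace of the normal derivative vanishes; it needs neither traces nor
  regularity of the boundary.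
\<close>

definition H2_neumann :: "'a::euclidean_space set \<Rightarrow> ('a \<Rightarrow> real) set" where
  "H2_neumann \<Omega> = {u \<in> H2 \<Omega>. \<forall>v\<in>H1 \<Omega>.
     - l2_inner \<Omega> (weak_laplacian \<Omega> u) v = l2_inner \<Omega> (weak_grad \<Omega> u) (weak_grad \<Omega> v)}"

definition box_periodic ::
    "'a::euclidean_space \<Rightarrow> 'a \<Rightarrow> ('a \<Rightarrow> real) \<Rightarrow> bool" where
  "box_periodic a b f \<longleftrightarrow> (\<forall>i\<in>Basis. \<forall>x. f (x + ((b - a) \<bullet> i) *\<^sub>R i) = f x)"

text \<open>
  The periodic Sobolev space on the box with corners \<open>a\<close> and \<open>b\<close>: the closure of the smooth
  periodic functions in \<open>H\<^sup>2\<close>. The functions \<open>\<psi>\<close> are periodic on the whole space; \<open>u\<close> matters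
  only on the box.
\<close>

definition H2_periodic :: "'a::euclidean_space \<Rightarrow> 'a \<Rightarrow> ('a \<Rightarrow> real) set" where
  "H2_periodic a b = {u \<in> H2 (box a b). \<forall>e>0. \<exists>\<psi>. smooth \<psi> \<and> box_periodic a b \<psi> \<and>
     l2_norm (box a b) (\<lambda>x. u x - \<psi> x) < e \<and>
     (\<forall>i\<in>Basis. l2_norm (box a b) (\<lambda>x. weak_partial (box a b) i u x - partial i \<psi> x) < e) \<and>
     (\<forall>i\<in>Basis. \<forall>j\<in>Basis. l2_norm (box a b)
        (\<lambda>x. weak_partial (box a b) j (weak_partial (box a b) i u) x
             - partial j (partial i \<psi>) x) < e)}"


section \<open>The L1 discretization of the fractional derivative\<close>

definition tau :: "(nat \<Rightarrow> real) \<Rightarrow> nat \<Rightarrow> real" where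
  "tau t n = t n - t (n - 1)"

text \<open>
  \<open>L1_coeff \<alpha> t n j\<close> is the coefficient \<open>b\<^sub>j\<close> at time level \<open>n + 1\<close>, so \<open>j = n - k\<close> corresponds to
  the subinterval from \<open>t k\<close> to \<open>t (k + 1)\<close>; it is meaningful for \<open>j \<le> n\<close>.
\<close>

definition L1_coeff :: "real \<Rightarrow> (nat \<Rightarrow> real) \<Rightarrow> nat \<Rightarrow> nat \<Rightarrow> real" where
  "L1_coeff \<alpha> t n j = 1 / Gamma (1 - \<alpha>) *
     (LINT s:{t (n - j)..t (n - j + 1)}|lborel. (t (n + 1) - s) powr (- \<alpha>))"

text \<open>Both operators below give the value at time level \<open>n + 1\<close>.\<close>

definition L_low ::
    "real \<Rightarrow> (nat \<Rightarrow> real) \<Rightarrow> (nat \<Rightarrow> 'a \<Rightarrow> real) \<Rightarrow> nat \<Rightarrow> 'a \<Rightarrow> real" where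
  "L_low \<alpha> t \<phi> n x = L1_coeff \<alpha> t n 0 * ((\<phi> (n + 1) x - \<phi> n x) / tau t (n + 1))"

definition L_high ::
    "real \<Rightarrow> (nat \<Rightarrow> real) \<Rightarrow> (nat \<Rightarrow> 'a \<Rightarrow> real) \<Rightarrow> nat \<Rightarrow> 'a \<Rightarrow> real" where
  "L_high \<alpha> t \<phi> n x =
     (\<Sum>k<n. L1_coeff \<alpha> t n (n - k) * ((\<phi> (k + 1) x - \<phi> k x) / tau t (k + 1)))"


section \<open>The discrete energy\<close>

definition energy ::
    "'a::euclidean_space set \<Rightarrow> real \<Rightarrow> real \<Rightarrow> (nat \<Rightarrow> 'a \<Rightarrow> real) \<Rightarrow> (nat \<Rightarrow> real) \<Rightarrow> nat \<Rightarrow> real" where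
  "energy \<Omega> \<epsilon> \<theta> \<phi> R n =
     1 / 2 * (\<epsilon>\<^sup>2 - \<theta>\<^sup>2) * (l2_norm \<Omega> (weak_grad \<Omega> (\<phi> n)))\<^sup>2 + \<bar>R n\<bar>\<^sup>2"

end

theory Submission
  imports Defs
begin

text \<open>
  The energy law comes from testing the first equation with the increment. Fix a step and write
  \<open>u\<close>, \<open>w\<close> for \<open>\<phi> n\<close>, \<open>\<phi> (n + 1)\<close> and \<open>R\<close>, \<open>S\<close> for the auxiliary variable at the same two levels. Let
  \<open>d = w - u\<close>, \<open>r = S / R\<close>, and let \<open>G = - \<theta>\<^sup>2 \<Delta>u + F'(u) + L\<^sub>h w\<close> be the explicit part. Collecting
  terms, the equation reads \<open>L\<^sub>l w - \<epsilon>\<^sup>2 \<Delta>w + \<theta>\<^sup>2 \<Delta>u + r G = 0\<close>. Paired with \<open>d\<close>, each part has a sign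
  or telescopes:

  \<^item> \<open>(L\<^sub>l w, d) = (b\<^sub>0 / \<tau>) \<parallel>d\<parallel>\<^sup>2 \<ge> 0\<close>. The memory terms of the fractional derivative all sit in \<open>G\<close>, so
    no two time steps are ever compared and the mesh can be arbitrary.
  \<^item> By Green's formula and polarization, the two Laplacians contribute
    \<open>(\<epsilon>\<^sup>2 - \<theta>\<^sup>2) / 2 (\<parallel>\<nabla>w\<parallel>\<^sup>2 - \<parallel>\<nabla>u\<parallel>\<^sup>2) + (\<epsilon>\<^sup>2 + \<theta>\<^sup>2) / 2 \<parallel>\<nabla>w - \<nabla>u\<parallel>\<^sup>2\<close>
    (lemma \<open>imex_gradient_estimate\<close>).
  \<^item> The equation for the auxiliary variable says that \<open>2 R (S - R) = (G, d)\<close>, whence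
    \<open>r (G, d) = 2 S (S - R) = S\<^sup>2 - R\<^sup>2 + (S - R)\<^sup>2\<close>, whatever \<open>G\<close> is.

  The sum of the three is zero, and dropping the squares leaves the claim.

  The analytic input is Green's formula. Under the Neumann condition it holds by definition. In the
  periodic case it is lemma \<open>green_H2_periodic\<close>: for smooth periodic functions it follows by the
  product rule, since a partial derivative of a periodic function has mean zero over a period
  (lemma \<open>integral_partial_periodic_eq_0\<close>), and it extends to the closure in \<open>H\<^sup>2\<close> by continuity of
  the inner product.
\<close>

section \<open>The algebra of \<open>L\<^sup>2(\<Omega>)\<close>\<close>

lemma L2_mult_integrable:
  assumes u: "u \<in> L2 \<Omega>" and v: "v \<in> L2 \<Omega>"
  shows "integrable (lebesgue_on \<Omega>) (\<lambda>x. u x * v x)"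
proof (rule Bochner_Integration.integrable_bound)
  show "integrable (lebesgue_on \<Omega>) (\<lambda>x. (u x)\<^sup>2 + (v x)\<^sup>2)"
    using u v by (auto simp: L2_def)
  have [measurable]: "u \<in> borel_measurable (lebesgue_on \<Omega>)" "v \<in> borel_measurable (lebesgue_on \<Omega>)"
    using u v by (auto simp: L2_def)
  show "(\<lambda>x. u x * v x) \<in> borel_measurable (lebesgue_on \<Omega>)"
    by measurable
  have "\<bar>c * d\<bar> \<le> c\<^sup>2 + d\<^sup>2" for c d :: real
    using sum_squares_bound[of "\<bar>c\<bar>" "\<bar>d\<bar>"] abs_ge_zero[of "c * d"]
    unfolding abs_mult power2_abs by linarith
  then show "AE x in lebesgue_on \<Omega>. norm (u x * v x) \<le> norm ((u x)\<^sup>2 + (v x)\<^sup>2)"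
    by auto
qed

lemma L2_cmult: "u \<in> L2 \<Omega> \<Longrightarrow> (\<lambda>x. c * u x) \<in> L2 \<Omega>"
  by (auto simp: L2_def power_mult_distrib)

lemma L2_add:
  assumes u: "u \<in> L2 \<Omega>" and v: "v \<in> L2 \<Omega>"
  shows "(\<lambda>x. u x + v x) \<in> L2 \<Omega>"
proof -
  have "integrable (lebesgue_on \<Omega>) (\<lambda>x. (u x)\<^sup>2 + (v x)\<^sup>2 + 2 * (u x * v x))"
    using u v L2_mult_integrable[OF u v] by (auto simp: L2_def)
  moreover have "(\<lambda>x. (u x)\<^sup>2 + (v x)\<^sup>2 + 2 * (u x * v x)) = (\<lambda>x. (u x + v x)\<^sup>2)"
    by (auto simp: power2_sum)
  ultimately show ?thesis
    using u v by (auto simp: L2_def)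
qed

lemma L2_diff: "u \<in> L2 \<Omega> \<Longrightarrow> v \<in> L2 \<Omega> \<Longrightarrow> (\<lambda>x. u x - v x) \<in> L2 \<Omega>"
  using L2_add[of u \<Omega> "\<lambda>x. - 1 * v x"] L2_cmult[of v \<Omega> "-1"] by simp

lemma L2_sum:
  assumes "\<And>k. k \<in> I \<Longrightarrow> u k \<in> L2 \<Omega>"
  shows "(\<lambda>x. \<Sum>k\<in>I. u k x) \<in> L2 \<Omega>"
  using assms
proof (induction I rule: infinite_finite_induct)
  case (insert k I)
  then show ?case by (simp add: L2_add)
qed (auto simp: L2_def)

lemma l2_inner_commute: "l2_inner \<Omega> u v = l2_inner \<Omega> v u"
  by (simp add: l2_inner_def inner_commute)

lemma l2_inner_self_nonneg: "0 \<le> l2_inner \<Omega> u u"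
  by (simp add: l2_inner_def)

lemma l2_norm_nonneg: "0 \<le> l2_norm \<Omega> u"
  by (simp add: l2_norm_def l2_inner_self_nonneg)

lemma l2_norm_power2: "(l2_norm \<Omega> u)\<^sup>2 = l2_inner \<Omega> u u"
  by (simp add: l2_norm_def l2_inner_self_nonneg)

lemma l2_inner_cmult_left: "l2_inner \<Omega> (\<lambda>x. c * u x) v = c * l2_inner \<Omega> u (v :: _ \<Rightarrow> real)"
  by (simp add: l2_inner_def mult.assoc)

lemma l2_inner_cmult_right: "l2_inner \<Omega> u (\<lambda>x. c * v x) = c * l2_inner \<Omega> u (v :: _ \<Rightarrow> real)"
  by (simp add: l2_inner_def mult.left_commute)

lemma l2_inner_add_left:
  assumes "u \<in> L2 \<Omega>" "v \<in> L2 \<Omega>" "w \<in> L2 \<Omega>"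
  shows "l2_inner \<Omega> (\<lambda>x. u x + v x) w = l2_inner \<Omega> u w + l2_inner \<Omega> v w"
  using assms by (simp add: l2_inner_def distrib_right L2_mult_integrable)

lemma l2_inner_diff_left:
  assumes "u \<in> L2 \<Omega>" "v \<in> L2 \<Omega>" "w \<in> L2 \<Omega>"
  shows "l2_inner \<Omega> (\<lambda>x. u x - v x) w = l2_inner \<Omega> u w - l2_inner \<Omega> v w"
  using assms by (simp add: l2_inner_def left_diff_distrib L2_mult_integrable)

lemma l2_inner_diff_right:
  assumes "u \<in> L2 \<Omega>" "v \<in> L2 \<Omega>" "w \<in> L2 \<Omega>"
  shows "l2_inner \<Omega> w (\<lambda>x. u x - v x) = l2_inner \<Omega> w u - l2_inner \<Omega> w v"
  using assms by (simp add: l2_inner_def right_diff_distrib L2_mult_integrable)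

lemma l2_inner_sum_left:
  assumes "\<And>k. k \<in> I \<Longrightarrow> u k \<in> L2 \<Omega>" "w \<in> L2 \<Omega>"
  shows "l2_inner \<Omega> (\<lambda>x. \<Sum>k\<in>I. u k x) w = (\<Sum>k\<in>I. l2_inner \<Omega> (u k) w)"
  using assms by (simp add: l2_inner_def sum_distrib_right L2_mult_integrable)

text \<open>
  Young's inequality with the weight \<open>e\<close> takes the place of the Cauchy--Schwarz inequality: for the
  density argument below it suffices that the inner product is of order \<open>e\<close>.
\<close>

lemma l2_inner_small:
  assumes u: "u \<in> L2 \<Omega>" and v: "v \<in> L2 \<Omega>" and small: "l2_norm \<Omega> u < e"
  shows "\<bar>l2_inner \<Omega> u v\<bar> \<le> e / 2 * (1 + l2_inner \<Omega> v v)"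
proof -
  have e: "e > 0"
    using small by (rule le_less_trans[rotated]) (rule l2_norm_nonneg)
  have "\<bar>l2_inner \<Omega> u v\<bar> \<le> (LINT x|lebesgue_on \<Omega>. \<bar>u x * v x\<bar>)"
    by (simp add: l2_inner_def)
  also have "\<dots> \<le> (LINT x|lebesgue_on \<Omega>. 1 / (2 * e) * (u x)\<^sup>2 + e / 2 * (v x)\<^sup>2)"
  proof (rule integral_mono)
    show "integrable (lebesgue_on \<Omega>) (\<lambda>x. \<bar>u x * v x\<bar>)"
      using L2_mult_integrable[OF u v] by simp
    show "integrable (lebesgue_on \<Omega>) (\<lambda>x. 1 / (2 * e) * (u x)\<^sup>2 + e / 2 * (v x)\<^sup>2)"
      using u v by (auto simp: L2_def)
    fix x
    have "2 * \<bar>u x\<bar> * (e * \<bar>v x\<bar>) \<le> \<bar>u x\<bar>\<^sup>2 + (e * \<bar>v x\<bar>)\<^sup>2"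
      by (rule sum_squares_bound)
    then show "\<bar>u x * v x\<bar> \<le> 1 / (2 * e) * (u x)\<^sup>2 + e / 2 * (v x)\<^sup>2"
      using e by (simp add: field_simps abs_mult power2_eq_square)
  qed
  also have "\<dots> = 1 / (2 * e) * l2_inner \<Omega> u u + e / 2 * l2_inner \<Omega> v v"
    using u v by (simp add: L2_def l2_inner_def power2_eq_square)
  also have "l2_inner \<Omega> u u \<le> e\<^sup>2"
    using small unfolding l2_norm_power2[symmetric]
    by (intro power_mono) (auto simp: l2_norm_nonneg)
  finally show ?thesis
    using e by (simp add: field_simps power2_eq_square)
qed

lemma l2_inner_perturb:
  assumes L2: "u \<in> L2 \<Omega>" "v \<in> L2 \<Omega>" "p \<in> L2 \<Omega>" "q \<in> L2 \<Omega>"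
    and small: "l2_norm \<Omega> (\<lambda>x. u x - p x) < e" "l2_norm \<Omega> (\<lambda>x. v x - q x) < e" and e: "e \<le> 1"
  shows "\<bar>l2_inner \<Omega> u v - l2_inner \<Omega> p q\<bar> \<le> e / 2 * (4 + l2_inner \<Omega> u u + l2_inner \<Omega> v v)"
proof -
  let ?f = "\<lambda>x. u x - p x" and ?g = "\<lambda>x. v x - q x"
  have fg: "?f \<in> L2 \<Omega>" "?g \<in> L2 \<Omega>"
    using L2 by (auto intro: L2_diff)
  have e0: "0 < e"
    using small(1) by (rule le_less_trans[rotated]) (rule l2_norm_nonneg)
  have "(l2_norm \<Omega> ?g)\<^sup>2 \<le> 1\<^sup>2"
    using small(2) e by (intro power_mono l2_norm_nonneg) simp
  then have "1 + l2_inner \<Omega> ?g ?g \<le> 2"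
    by (simp add: l2_norm_power2)
  then have "e / 2 * (1 + l2_inner \<Omega> ?g ?g) \<le> e / 2 * 2"
    using e0 by (intro mult_left_mono) auto
  then have "\<bar>l2_inner \<Omega> ?f ?g\<bar> \<le> e"
    using l2_inner_small[OF fg small(1)] by linarith
  moreover have "l2_inner \<Omega> u v - l2_inner \<Omega> p q
      = l2_inner \<Omega> ?f v + l2_inner \<Omega> ?g u - l2_inner \<Omega> ?f ?g"
    using L2 fg by (simp add: l2_inner_diff_left l2_inner_diff_right l2_inner_commute[of \<Omega> v u]
        l2_inner_commute[of \<Omega> q u])
  moreover have "\<bar>l2_inner \<Omega> ?f v\<bar> \<le> e / 2 * (1 + l2_inner \<Omega> v v)"
    by (rule l2_inner_small[OF fg(1) L2(2) small(1)])
  moreover have "\<bar>l2_inner \<Omega> ?g u\<bar> \<le> e / 2 * (1 + l2_inner \<Omega> u u)"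
    by (rule l2_inner_small[OF fg(2) L2(1) small(2)])
  ultimately show ?thesis
    by (simp add: algebra_simps)
qed


section \<open>Weak derivatives of Sobolev functions\<close>

lemma has_weak_partial_weak_partial:
  "u \<in> H1 \<Omega> \<Longrightarrow> i \<in> Basis \<Longrightarrow> has_weak_partial \<Omega> i u (weak_partial \<Omega> i u)"
  unfolding H1_def weak_partial_def by (simp add: someI_ex)

lemma H1_weak_partial_L2: "u \<in> H1 \<Omega> \<Longrightarrow> i \<in> Basis \<Longrightarrow> weak_partial \<Omega> i u \<in> L2 \<Omega>"
  using has_weak_partial_weak_partial by (auto simp: has_weak_partial_def)

lemma H2_weak_partial2_L2:
  "u \<in> H2 \<Omega> \<Longrightarrow> i \<in> Basis \<Longrightarrow> weak_partial \<Omega> i (weak_partial \<Omega> i u) \<in> L2 \<Omega>"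
  by (auto simp: H2_def intro: H1_weak_partial_L2)

lemma H2_weak_laplacian_L2: "u \<in> H2 \<Omega> \<Longrightarrow> weak_laplacian \<Omega> u \<in> L2 \<Omega>"
  unfolding weak_laplacian_def[abs_def] by (intro L2_sum H2_weak_partial2_L2)

lemma l2_inner_weak_grad:
  fixes \<Omega> :: "'a::euclidean_space set"
  assumes "u \<in> H1 \<Omega>" "v \<in> H1 \<Omega>"
  shows "l2_inner \<Omega> (weak_grad \<Omega> u) (weak_grad \<Omega> v)
    = (\<Sum>i\<in>Basis. l2_inner \<Omega> (weak_partial \<Omega> i u) (weak_partial \<Omega> i v))"
proof -
  have "weak_grad \<Omega> u x \<bullet> weak_grad \<Omega> v x
      = (\<Sum>i\<in>Basis. weak_partial \<Omega> i u x * weak_partial \<Omega> i v x)" for x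
    by (subst euclidean_inner) (simp add: weak_grad_def)
  then show ?thesis
    using assms by (simp add: l2_inner_def H1_weak_partial_L2 L2_mult_integrable)
qed

lemma l2_inner_weak_grad_le:
  assumes u: "u \<in> H1 \<Omega>" and v: "v \<in> H1 \<Omega>"
  shows "2 * l2_inner \<Omega> (weak_grad \<Omega> u) (weak_grad \<Omega> v)
    \<le> l2_inner \<Omega> (weak_grad \<Omega> u) (weak_grad \<Omega> u) + l2_inner \<Omega> (weak_grad \<Omega> v) (weak_grad \<Omega> v)"
proof -
  have "2 * l2_inner \<Omega> p q \<le> l2_inner \<Omega> p p + l2_inner \<Omega> q q"
    if "p \<in> L2 \<Omega>" "q \<in> L2 \<Omega>" for p q :: "'a \<Rightarrow> real"
    using that l2_inner_self_nonneg[of \<Omega> "\<lambda>x. p x - q x"] l2_inner_commute[of \<Omega> p q]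
    by (simp add: l2_inner_diff_left l2_inner_diff_right L2_diff)
  then show ?thesis
    using u v unfolding l2_inner_weak_grad[OF u v] l2_inner_weak_grad[OF u u] l2_inner_weak_grad[OF v v]
    by (simp add: sum_distrib_left sum.distrib[symmetric] sum_mono H1_weak_partial_L2)
qed


section \<open>Integration by parts over a period\<close>

text \<open>
  Cut the enlarged box with corners \<open>a\<close> and \<open>b + h i\<close> at the height of \<open>b\<close> and at the height of
  \<open>a + h i\<close>. Besides the two boxes in the claim this leaves the slab on top of the first and the
  slab below the second, and these differ by one period.
\<close>

lemma integral_cbox_periodic_shift:
  fixes g :: "'a::euclidean_space \<Rightarrow> real"
  assumes i: "i \<in> Basis" and ab: "a \<bullet> i < b \<bullet> i" and h: "0 \<le> h"
    and cont: "continuous_on UNIV g"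
    and per: "\<And>x. g (x + ((b - a) \<bullet> i) *\<^sub>R i) = g x"
  shows "integral (cbox a b) (\<lambda>x. g (x + h *\<^sub>R i)) = integral (cbox a b) g"
proof -
  define L where "L = (b - a) \<bullet> i"
  let ?I = "\<lambda>c d. integral (cbox c d) g"
  have int: "g integrable_on cbox c d" for c d
    using cont by (intro integrable_continuous) (auto intro: continuous_on_subset)
  have low: "cbox c d \<inter> {x. x \<bullet> i \<le> m} = cbox c (d + (m - d \<bullet> i) *\<^sub>R i)"
    if "m \<le> d \<bullet> i" for c d m
    using i that by (fastforce simp: mem_box inner_simps inner_Basis split: if_splits)
  have high: "cbox c d \<inter> {x. x \<bullet> i \<ge> m} = cbox (c + (m - c \<bullet> i) *\<^sub>R i) d"
    if "c \<bullet> i \<le> m" for c d m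
    using i that by (fastforce simp: mem_box inner_simps inner_Basis split: if_splits)
  have split: "?I c d = ?I c (d + (m - d \<bullet> i) *\<^sub>R i) + ?I (c + (m - c \<bullet> i) *\<^sub>R i) d"
    if "c \<bullet> i \<le> m" "m \<le> d \<bullet> i" for c d m
    using integral_split[OF int i, of c d m] low[OF that(2), of c] high[OF that(1), of d] by simp
  have shift: "integral (cbox c d) (\<lambda>x. g (x + s)) = ?I (c + s) (d + s)" for c d s
    using integral_shift_cbox[of "c + s" s "d + s" g] by simp
  have ii: "i \<bullet> i = 1"
    using i by simp
  have "?I a (b + h *\<^sub>R i) = ?I a b + ?I (a + L *\<^sub>R i) (b + h *\<^sub>R i)"
    using split[of a "b \<bullet> i" "b + h *\<^sub>R i"] ab h ii by (simp add: L_def inner_simps)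
  moreover have "?I a (b + h *\<^sub>R i) = ?I a (b + (h - L) *\<^sub>R i) + ?I (a + h *\<^sub>R i) (b + h *\<^sub>R i)"
    using split[of a "a \<bullet> i + h" "b + h *\<^sub>R i"] ab h ii
    by (simp add: L_def inner_simps algebra_simps)
  moreover have "?I (a + L *\<^sub>R i) (b + h *\<^sub>R i) = ?I a (b + (h - L) *\<^sub>R i)"
    using shift[of a "b + (h - L) *\<^sub>R i" "L *\<^sub>R i"] per by (simp add: L_def algebra_simps)
  ultimately show ?thesis
    using shift[of a b "h *\<^sub>R i"] by simp
qed

text \<open>
  By the preceding lemma, the integral of \<open>f\<close> over the box translated by \<open>s i\<close> is the same for all
  \<open>s \<ge> 0\<close>. Differentiating it under the integral sign at \<open>s = 0\<close> gives the integral of the partial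
  derivative.
\<close>

lemma integral_partial_periodic_eq_0:
  fixes f :: "'a::euclidean_space \<Rightarrow> real"
  assumes i: "i \<in> Basis" and ab: "a \<bullet> i < b \<bullet> i"
    and diff: "\<And>x. f differentiable (at x)" and cont: "continuous_on UNIV (partial i f)"
    and per: "\<And>x. f (x + ((b - a) \<bullet> i) *\<^sub>R i) = f x"
  shows "integral (cbox a b) (partial i f) = 0"
proof -
  have contf: "continuous_on UNIV f"
    using diff by (meson continuous_at_imp_continuous_on differentiable_imp_continuous_within)
  let ?J = "\<lambda>s. integral (cbox a b) (\<lambda>x. f (x + s *\<^sub>R i))"
  have "(?J has_field_derivative integral (cbox a b) (\<lambda>x. partial i f (x + 0 *\<^sub>R i)))
      (at 0 within {0..1})"
  proof (rule leibniz_rule_field_derivative[where fx = "\<lambda>s x. partial i f (x + s *\<^sub>R i)"])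
    fix s :: real and x :: 'a
    let ?f' = "frechet_derivative f (at (x + s *\<^sub>R i))"
    have f': "(f has_derivative ?f') (at (x + s *\<^sub>R i))"
      using diff by (simp add: frechet_derivative_works[symmetric])
    have "((\<lambda>s. f (x + s *\<^sub>R i)) has_derivative (\<lambda>h. ?f' (h *\<^sub>R i))) (at s within {0..1})"
      by (rule has_derivative_compose[where g = f and g' = ?f'])
        (auto intro!: derivative_eq_intros f')
    moreover have "(\<lambda>h. ?f' (h *\<^sub>R i)) = (*) (partial i f (x + s *\<^sub>R i))"
      using linear_cmul[OF has_derivative_linear[OF f']] by (auto simp: partial_def)
    ultimately show "((\<lambda>s. f (x + s *\<^sub>R i)) has_field_derivative partial i f (x + s *\<^sub>R i))
        (at s within {0..1})"
      by (simp add: has_field_derivative_def)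
  next
    show "(\<lambda>x. f (x + s *\<^sub>R i)) integrable_on cbox a b" for s
      by (intro integrable_continuous continuous_on_compose2[OF contf] continuous_intros) auto
    show "continuous_on ({0..1} \<times> cbox a b) (\<lambda>(s, x). partial i f (x + s *\<^sub>R i))"
      unfolding split_beta
      by (intro continuous_on_compose2[OF cont] continuous_intros) auto
  qed auto
  moreover have "(?J has_field_derivative 0) (at 0 within {0..1})"
  proof (rule has_field_derivative_transform_within[where f = "\<lambda>_. integral (cbox a b) f" and d = 1])
    show "integral (cbox a b) f = ?J s" if "s \<in> {0..1}" for s
      using integral_cbox_periodic_shift[OF i ab _ contf per] that by simp
  qed auto
  ultimately have "integral (cbox a b) (\<lambda>x. partial i f (x + 0 *\<^sub>R i)) = 0"
    using vector_derivative_unique_within_closed_interval[of 0 1 0 ?J]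
    unfolding has_real_derivative_iff_has_vector_derivative by simp
  then show ?thesis by simp
qed

lemma smooth_differentiable: "smooth f \<Longrightarrow> f differentiable (at x)"
  unfolding smooth_def using Ck.simps(2)[of 0 f] by blast

lemma smooth_partial: "smooth f \<Longrightarrow> i \<in> Basis \<Longrightarrow> smooth (partial i f)"
  unfolding smooth_def using Ck.simps(2) by blast

lemma smooth_continuous: "smooth f \<Longrightarrow> continuous_on UNIV f"
  unfolding smooth_def using Ck.simps(1) by blast

lemma continuous_integrable_box:
  fixes f :: "'a::euclidean_space \<Rightarrow> real"
  assumes "continuous_on UNIV f"
  shows "integrable (lebesgue_on (box a b)) f"
proof -
  have "f absolutely_integrable_on cbox a b"
    using assms by (intro absolutely_integrable_continuous) (auto intro: continuous_on_subset)
  then have "f absolutely_integrable_on box a b"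
    by (rule set_integrable_subset) (auto simp: box_subset_cbox)
  then show ?thesis
    by (simp add: integrable_restrict_space set_integrable_def)
qed

lemma continuous_L2_box: "continuous_on UNIV f \<Longrightarrow> f \<in> L2 (box a b)"
  unfolding L2_def
  by (auto intro!: continuous_integrable_box continuous_intros borel_measurable_integrable)

lemma partial_periodic:
  fixes f :: "'a::euclidean_space \<Rightarrow> real"
  assumes "\<And>x. f (x + c) = f x"
  shows "partial i f (x + c) = partial i f x"
proof -
  have shift: "(f has_derivative D) (at x)"
    if per: "\<And>x. f (x + c) = f x" and D: "(f has_derivative D) (at (x + c))" for c x D
  proof -
    have "((\<lambda>y. f (y + c)) has_derivative (\<lambda>h. D h)) (at x)"
      by (rule has_derivative_compose[where g = f and g' = D])
        (auto intro!: derivative_eq_intros D)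
    then show ?thesis by (simp add: per)
  qed
  have "f (x - c) = f x" for x
    using assms[of "x - c"] by simp
  then have "(f has_derivative D) (at (x + c)) \<longleftrightarrow> (f has_derivative D) (at x)" for D
    using shift[OF assms, of D x] shift[of "- c" D "x + c"] by auto
  then show ?thesis by (simp add: partial_def frechet_derivative_def)
qed

lemma green_smooth_periodic:
  fixes \<psi> \<eta> :: "'a::euclidean_space \<Rightarrow> real"
  assumes i: "i \<in> Basis" and ab: "a \<bullet> i < b \<bullet> i"
    and \<psi>: "smooth \<psi>" "box_periodic a b \<psi>" and \<eta>: "smooth \<eta>" "box_periodic a b \<eta>"
  shows "l2_inner (box a b) (partial i (partial i \<psi>)) \<eta>
    + l2_inner (box a b) (partial i \<psi>) (partial i \<eta>) = 0"
proof -
  let ?\<psi>i = "partial i \<psi>"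
  let ?f = "\<lambda>x. ?\<psi>i x * \<eta> x"
  have sm: "smooth ?\<psi>i" "smooth (partial i ?\<psi>i)" "smooth (partial i \<eta>)"
    using \<psi> \<eta> i by (auto intro: smooth_partial)
  note cont = sm[THEN smooth_continuous] \<eta>(1)[THEN smooth_continuous]
  have D: "(?f has_derivative (\<lambda>h. ?\<psi>i x * frechet_derivative \<eta> (at x) h
      + frechet_derivative ?\<psi>i (at x) h * \<eta> x)) (at x)" for x
    using sm(1) \<eta>(1)
    by (intro has_derivative_mult) (auto simp: frechet_derivative_works[symmetric] smooth_differentiable)
  have pf: "partial i ?f = (\<lambda>x. partial i ?\<psi>i x * \<eta> x + ?\<psi>i x * partial i \<eta> x)"
    using frechet_derivative_at[OF D, symmetric] by (simp add: partial_def add.commute)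
  have contpf: "continuous_on UNIV (partial i ?f)"
    unfolding pf by (intro continuous_intros cont)
  have "integral (cbox a b) (partial i ?f) = 0"
  proof (rule integral_partial_periodic_eq_0[OF i ab _ contpf])
    show "?f differentiable (at x)" for x
      using D by (auto simp: differentiable_def)
    show "?f (x + ((b - a) \<bullet> i) *\<^sub>R i) = ?f x" for x
      using \<psi>(2) \<eta>(2) i partial_periodic[of \<psi> "((b - a) \<bullet> i) *\<^sub>R i" i x]
      by (simp add: box_periodic_def)
  qed
  moreover have "integral\<^sup>L (lebesgue_on (box a b)) (partial i ?f)
      = integral (cbox a b) (partial i ?f)"
    by (simp add: lebesgue_integral_eq_integral continuous_integrable_box[OF contpf]
        integral_open_interval)
  ultimately show ?thesis
    unfolding pf l2_inner_def
    by (simp add: continuous_integrable_box continuous_on_mult cont)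
qed

text \<open>
  Both sides of Green's formula are continuous in the norms in which the smooth periodic functions
  are dense, so the formula passes from them to the closure, one coordinate direction at a time.
\<close>

lemma green_H2_periodic_partial:
  fixes u v :: "'a::euclidean_space \<Rightarrow> real"
  assumes i: "i \<in> Basis" and ab: "a \<bullet> i < b \<bullet> i"
    and u: "u \<in> H2_periodic a b" and v: "v \<in> H2_periodic a b"
  defines "ui \<equiv> weak_partial (box a b) i u" and "vi \<equiv> weak_partial (box a b) i v"
  defines "uii \<equiv> weak_partial (box a b) i ui"
  shows "l2_inner (box a b) uii v + l2_inner (box a b) ui vi = 0"
proof -
  let ?ip = "l2_inner (box a b)"
  have H: "u \<in> H2 (box a b)" "v \<in> H2 (box a b)" "u \<in> H1 (box a b)" "v \<in> H1 (box a b)"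
    using u v by (auto simp: H2_periodic_def H2_def)
  have L2: "v \<in> L2 (box a b)" "ui \<in> L2 (box a b)" "vi \<in> L2 (box a b)" "uii \<in> L2 (box a b)"
    using H i by (auto simp: ui_def vi_def uii_def H1_weak_partial_L2 H2_weak_partial2_L2)
      (auto simp: H1_def)
  define C where "C = 8 + ?ip uii uii + ?ip v v + ?ip ui ui + ?ip vi vi"
  have C: "C > 0"
    unfolding C_def using l2_inner_self_nonneg by (smt (verit))
  have bound: "\<bar>?ip uii v + ?ip ui vi\<bar> \<le> e / 2 * C" if e: "0 < e" "e \<le> 1" for e
  proof -
    obtain \<psi> where \<psi>: "smooth \<psi>" "box_periodic a b \<psi>"
      "l2_norm (box a b) (\<lambda>x. ui x - partial i \<psi> x) < e"
      "l2_norm (box a b) (\<lambda>x. uii x - partial i (partial i \<psi>) x) < e"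
      using u e i unfolding H2_periodic_def ui_def uii_def by blast
    obtain \<eta> where \<eta>: "smooth \<eta>" "box_periodic a b \<eta>"
      "l2_norm (box a b) (\<lambda>x. v x - \<eta> x) < e"
      "l2_norm (box a b) (\<lambda>x. vi x - partial i \<eta> x) < e"
      using v e i unfolding H2_periodic_def vi_def by blast
    have L2': "\<eta> \<in> L2 (box a b)" "partial i \<psi> \<in> L2 (box a b)" "partial i \<eta> \<in> L2 (box a b)"
      "partial i (partial i \<psi>) \<in> L2 (box a b)"
      using \<psi>(1) \<eta>(1) i by (auto intro!: continuous_L2_box smooth_continuous smooth_partial)
    have "\<bar>?ip uii v - ?ip (partial i (partial i \<psi>)) \<eta>\<bar> \<le> e / 2 * (4 + ?ip uii uii + ?ip v v)"
      using L2 L2' \<psi> \<eta> e by (intro l2_inner_perturb)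
    moreover have "\<bar>?ip ui vi - ?ip (partial i \<psi>) (partial i \<eta>)\<bar>
        \<le> e / 2 * (4 + ?ip ui ui + ?ip vi vi)"
      using L2 L2' \<psi> \<eta> e by (intro l2_inner_perturb)
    moreover have "?ip (partial i (partial i \<psi>)) \<eta> + ?ip (partial i \<psi>) (partial i \<eta>) = 0"
      using green_smooth_periodic[OF i ab \<psi>(1,2) \<eta>(1,2)] .
    ultimately show ?thesis
      unfolding C_def by (simp add: algebra_simps)
  qed
  \<comment> \<open>\<open>2 e / C\<close> turns the bound into \<open>e\<close>; the minimum keeps it in the admissible range.\<close>
  have "\<bar>?ip uii v + ?ip ui vi\<bar> \<le> 0 + e" if e: "0 < e" for e
  proof -
    have "\<bar>?ip uii v + ?ip ui vi\<bar> \<le> min 1 (2 * e / C) / 2 * C"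
      using e C by (intro bound) auto
    also have "\<dots> \<le> (2 * e / C) / 2 * C"
      using C by (intro mult_right_mono divide_right_mono min.cobounded2) auto
    also have "\<dots> = 0 + e"
      using C by simp
    finally show ?thesis .
  qed
  then have "\<bar>?ip uii v + ?ip ui vi\<bar> \<le> 0"
    by (rule field_le_epsilon)
  then show ?thesis by simp
qed

lemma green_H2_periodic:
  fixes u v :: "'a::euclidean_space \<Rightarrow> real"
  assumes ab: "\<forall>i\<in>Basis. a \<bullet> i < b \<bullet> i"
    and u: "u \<in> H2_periodic a b" and v: "v \<in> H2_periodic a b"
  shows "- l2_inner (box a b) (weak_laplacian (box a b) u) v
    = l2_inner (box a b) (weak_grad (box a b) u) (weak_grad (box a b) v)"
proof -
  let ?D = "weak_partial (box a b)"
  have H: "u \<in> H2 (box a b)" "u \<in> H1 (box a b)" "v \<in> H1 (box a b)" "v \<in> L2 (box a b)"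
    using u v by (auto simp: H2_periodic_def H2_def H1_def)
  have "l2_inner (box a b) (weak_laplacian (box a b) u) v
      = (\<Sum>i\<in>Basis. l2_inner (box a b) (?D i (?D i u)) v)"
    unfolding weak_laplacian_def[abs_def] using H
    by (intro l2_inner_sum_left H2_weak_partial2_L2)
  also have "\<dots> = (\<Sum>i\<in>Basis. - l2_inner (box a b) (?D i u) (?D i v))"
    using green_H2_periodic_partial[OF _ _ u v] ab
    by (intro sum.cong) (auto simp: eq_neg_iff_add_eq_0)
  also have "\<dots> = - l2_inner (box a b) (weak_grad (box a b) u) (weak_grad (box a b) v)"
    using H by (simp add: l2_inner_weak_grad sum_negf)
  finally show ?thesis by simp
qed


section \<open>The energy estimate\<close>

lemma L1_coeff_nonneg: "\<alpha> < 1 \<Longrightarrow> 0 \<le> L1_coeff \<alpha> t n j"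
  unfolding L1_coeff_def set_lebesgue_integral_def
  by (intro mult_nonneg_nonneg integral_nonneg) (auto simp: Gamma_real_pos less_imp_le)

lemma L_high_L2:
  assumes "\<And>k. k \<le> n \<Longrightarrow> \<phi> k \<in> L2 \<Omega>"
  shows "L_high \<alpha> t \<phi> n \<in> L2 \<Omega>"
proof -
  have "(\<lambda>x. L1_coeff \<alpha> t n (n - k) * (1 / tau t (k + 1) * (\<phi> (k + 1) x - \<phi> k x))) \<in> L2 \<Omega>"
    if "k < n" for k
    using that assms by (intro L2_cmult L2_diff) auto
  then show ?thesis
    unfolding L_high_def[abs_def] by (intro L2_sum) auto
qed

text \<open>
  The left-hand side differs from the right-hand side by \<open>(\<epsilon>\<^sup>2 + \<theta>\<^sup>2) / 2\<close> times the squared norm of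
  \<open>\<nabla>w - \<nabla>u\<close>: the implicit treatment of \<open>w\<close> and the explicit treatment of the subtracted term in
  \<open>u\<close> are both dissipative. Green's formula is assumed for \<open>u\<close> and \<open>w\<close> separately rather than for
  \<open>w - u\<close>, because the representatives chosen by \<open>weak_grad\<close> need not depend linearly on the function.
\<close>

lemma imex_gradient_estimate:
  fixes \<epsilon> \<theta> :: real
  assumes H: "u \<in> H2 \<Omega>" "w \<in> H2 \<Omega>"
    and green: "\<And>p q. p \<in> {u, w} \<Longrightarrow> q \<in> {u, w} \<Longrightarrow>
      - l2_inner \<Omega> (weak_laplacian \<Omega> p) q = l2_inner \<Omega> (weak_grad \<Omega> p) (weak_grad \<Omega> q)"
  shows "1 / 2 * (\<epsilon>\<^sup>2 - \<theta>\<^sup>2) * ((l2_norm \<Omega> (weak_grad \<Omega> w))\<^sup>2 - (l2_norm \<Omega> (weak_grad \<Omega> u))\<^sup>2)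
    \<le> - \<epsilon>\<^sup>2 * l2_inner \<Omega> (weak_laplacian \<Omega> w) (\<lambda>x. w x - u x)
      + \<theta>\<^sup>2 * l2_inner \<Omega> (weak_laplacian \<Omega> u) (\<lambda>x. w x - u x)"
proof -
  let ?g = "\<lambda>p q. l2_inner \<Omega> (weak_grad \<Omega> p) (weak_grad \<Omega> q)"
  have H1: "u \<in> H1 \<Omega>" "w \<in> H1 \<Omega>" "u \<in> L2 \<Omega>" "w \<in> L2 \<Omega>"
    using H by (auto simp: H2_def H1_def)
  have lap: "l2_inner \<Omega> (weak_laplacian \<Omega> p) (\<lambda>x. w x - u x) = ?g p u - ?g p w"
    if "p \<in> {u, w}" for p
  proof -
    have "l2_inner \<Omega> (weak_laplacian \<Omega> p) (\<lambda>x. w x - u x)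
        = l2_inner \<Omega> (weak_laplacian \<Omega> p) w - l2_inner \<Omega> (weak_laplacian \<Omega> p) u"
      using that H H1 by (intro l2_inner_diff_right) (auto intro: H2_weak_laplacian_L2)
    then show ?thesis
      using green[OF that, of u] green[OF that, of w] by simp
  qed
  have "0 \<le> (\<epsilon>\<^sup>2 + \<theta>\<^sup>2) / 2 * (?g w w + ?g u u - 2 * ?g w u)"
    using l2_inner_weak_grad_le[OF H1(2,1)] by (intro mult_nonneg_nonneg) auto
  then show ?thesis
    unfolding lap[OF insertI1] lap[OF insertI2[OF singletonI]] l2_norm_power2
      l2_inner_commute[of \<Omega> "weak_grad \<Omega> u" "weak_grad \<Omega> w"]
    by (simp add: field_simps)
qed

theorem theorem3p1:
  fixes \<Omega> :: "'a::euclidean_space set"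
    and F :: "real \<Rightarrow> real"
    and \<alpha> \<epsilon> \<theta> T :: real
    and t R :: "nat \<Rightarrow> real"
    and \<phi> :: "nat \<Rightarrow> 'a \<Rightarrow> real"
    and M :: nat
  assumes dim: "DIM('a) \<in> {1, 2, 3}"
    and domain: "open \<Omega>" "connected \<Omega>" "bounded \<Omega>" "\<Omega> \<noteq> {}"
    and F_diff: "\<And>s. F differentiable (at s)"
    and alpha: "0 < \<alpha>" "\<alpha> < 1"
    and theta: "\<theta>\<^sup>2 \<le> \<epsilon>\<^sup>2"
    and mesh: "t 0 = 0" "t M = T" "\<And>n. n < M \<Longrightarrow> t n < t (n + 1)"
    and bc: "(\<forall>n\<le>M. \<phi> n \<in> H2_neumann \<Omega>) \<or>
             (\<exists>a b. (\<forall>i\<in>Basis. a \<bullet> i < b \<bullet> i) \<and> \<Omega> = box a b \<and> (\<forall>n\<le>M. \<phi> n \<in> H2_periodic a b))"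
    and F_L2: "\<And>n. n \<le> M \<Longrightarrow> (\<lambda>x. deriv F (\<phi> n x)) \<in> L2 \<Omega>"
    and R_nz: "\<And>n. n < M \<Longrightarrow> R n \<noteq> 0"
    and scheme_phi: "\<And>n. n < M \<Longrightarrow> AE x in lebesgue_on \<Omega>.
          L_low \<alpha> t \<phi> n x - \<epsilon>\<^sup>2 * weak_laplacian \<Omega> (\<phi> (n + 1)) x
          + (1 - R (n + 1) / R n) * \<theta>\<^sup>2 * weak_laplacian \<Omega> (\<phi> n) x
          + R (n + 1) / R n * (deriv F (\<phi> n x) + L_high \<alpha> t \<phi> n x) = 0"
    and scheme_R: "\<And>n. n < M \<Longrightarrow>
          (R (n + 1) - R n) / tau t (n + 1) =
            1 / (2 * R n) *
            l2_inner \<Omega>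
              (\<lambda>x. - \<theta>\<^sup>2 * weak_laplacian \<Omega> (\<phi> n) x + deriv F (\<phi> n x) + L_high \<alpha> t \<phi> n x)
              (\<lambda>x. (\<phi> (n + 1) x - \<phi> n x) / tau t (n + 1))"
  shows "\<forall>n<M. energy \<Omega> \<epsilon> \<theta> \<phi> R (n + 1) - energy \<Omega> \<epsilon> \<theta> \<phi> R n \<le> 0"
proof (intro allI impI)
  fix n assume n: "n < M"
  let ?ip = "l2_inner \<Omega>" and ?u = "\<phi> n" and ?w = "\<phi> (n + 1)"
  define \<tau> where "\<tau> = tau t (n + 1)"
  define r where "r = R (n + 1) / R n"
  define d where "d = (\<lambda>x. ?w x - ?u x)"
  define G where
    "G = (\<lambda>x. - \<theta>\<^sup>2 * weak_laplacian \<Omega> ?u x + deriv F (?u x) + L_high \<alpha> t \<phi> n x)"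
  have \<tau>: "\<tau> > 0"
    using mesh(3)[OF n] by (simp add: \<tau>_def tau_def)
  have H2: "\<phi> k \<in> H2 \<Omega>" if "k \<le> M" for k
    using bc that by (auto simp: H2_neumann_def H2_periodic_def)
  then have L2: "\<phi> k \<in> L2 \<Omega>" if "k \<le> M" for k
    using that by (auto simp: H2_def H1_def)
  have green: "- ?ip (weak_laplacian \<Omega> (\<phi> k)) (\<phi> l) = ?ip (weak_grad \<Omega> (\<phi> k)) (weak_grad \<Omega> (\<phi> l))"
    if "k \<le> M" "l \<le> M" for k l
    using bc
  proof
    assume "\<forall>n\<le>M. \<phi> n \<in> H2_neumann \<Omega>"
    then show ?thesis
      using that by (auto simp: H2_neumann_def H2_def)
  next
    assume "\<exists>a b. (\<forall>i\<in>Basis. a \<bullet> i < b \<bullet> i) \<and> \<Omega> = box a b \<and> (\<forall>n\<le>M. \<phi> n \<in> H2_periodic a b)"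
    then show ?thesis
      using that green_H2_periodic by blast
  qed
  have lapL2: "weak_laplacian \<Omega> ?u \<in> L2 \<Omega>" "weak_laplacian \<Omega> ?w \<in> L2 \<Omega>"
    using n by (auto intro!: H2_weak_laplacian_L2 H2)
  have dL2: "d \<in> L2 \<Omega>"
    unfolding d_def using n by (intro L2_diff L2) auto
  have GL2: "G \<in> L2 \<Omega>"
    unfolding G_def using n lapL2 by (intro L2_add L2_cmult F_L2 L_high_L2 L2) auto

  \<comment> \<open>Testing the first equation with the increment \<open>d\<close>.\<close>
  define P where "P = (\<lambda>x. L1_coeff \<alpha> t n 0 / \<tau> * d x - \<epsilon>\<^sup>2 * weak_laplacian \<Omega> ?w x)"
  define Q where "Q = (\<lambda>x. P x + \<theta>\<^sup>2 * weak_laplacian \<Omega> ?u x)"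
  have PL2: "P \<in> L2 \<Omega>"
    unfolding P_def using lapL2 dL2 by (intro L2_diff L2_cmult)
  have QL2: "Q \<in> L2 \<Omega>"
    unfolding Q_def using PL2 lapL2 by (intro L2_add L2_cmult)
  have eq0: "AE x in lebesgue_on \<Omega>. Q x + r * G x = 0"
    using scheme_phi[OF n, folded r_def]
    by eventually_elim
      (simp add: P_def Q_def G_def L_low_def d_def \<tau>_def algebra_simps)
  have "?ip (\<lambda>x. Q x + r * G x) d = 0"
    unfolding l2_inner_def
    by (rule integral_eq_zero_AE) (use eq0 in eventually_elim, simp)
  moreover have "?ip (\<lambda>x. Q x + r * G x) d
      = L1_coeff \<alpha> t n 0 / \<tau> * ?ip d d - \<epsilon>\<^sup>2 * ?ip (weak_laplacian \<Omega> ?w) d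
        + \<theta>\<^sup>2 * ?ip (weak_laplacian \<Omega> ?u) d + r * ?ip G d"
  proof -
    have "?ip (\<lambda>x. Q x + r * G x) d = ?ip Q d + r * ?ip G d"
      using QL2 GL2 dL2 by (subst l2_inner_add_left) (auto simp: L2_cmult l2_inner_cmult_left)
    also have "?ip Q d = ?ip P d + \<theta>\<^sup>2 * ?ip (weak_laplacian \<Omega> ?u) d"
      unfolding Q_def using PL2 lapL2 dL2
      by (subst l2_inner_add_left) (auto simp: L2_cmult l2_inner_cmult_left)
    also have "?ip P d = L1_coeff \<alpha> t n 0 / \<tau> * ?ip d d - \<epsilon>\<^sup>2 * ?ip (weak_laplacian \<Omega> ?w) d"
      unfolding P_def using lapL2 dL2
      by (subst l2_inner_diff_left) (auto simp only: L2_cmult l2_inner_cmult_left)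
    finally show ?thesis .
  qed
  moreover have "0 \<le> L1_coeff \<alpha> t n 0 / \<tau> * ?ip d d"
    using \<tau> L1_coeff_nonneg[OF alpha(2)] l2_inner_self_nonneg
    by (intro mult_nonneg_nonneg divide_nonneg_pos) auto

  \<comment> \<open>The second equation, multiplied by \<open>2 R (n + 1)\<close>.\<close>
  moreover have "r * ?ip G d = 2 * R (n + 1) * (R (n + 1) - R n)"
  proof -
    have "(\<lambda>x. (?w x - ?u x) / \<tau>) = (\<lambda>x. 1 / \<tau> * d x)"
      by (simp add: d_def)
    then have "(R (n + 1) - R n) / \<tau> = 1 / (2 * R n) * (1 / \<tau> * ?ip G d)"
      using scheme_R[OF n, folded \<tau>_def G_def] by (simp only: l2_inner_cmult_right)
    then have "(R (n + 1) - R n) / \<tau> = (1 / (2 * R n) * ?ip G d) / \<tau>"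
      by simp
    then have "R (n + 1) - R n = 1 / (2 * R n) * ?ip G d"
      using \<tau> by (simp only: divide_cancel_right) auto
    then have "?ip G d = 2 * R n * (R (n + 1) - R n)"
      using R_nz[OF n] by (simp add: field_simps)
    then show ?thesis
      using R_nz[OF n] by (simp add: r_def)
  qed
  moreover have "(R (n + 1))\<^sup>2 - (R n)\<^sup>2 \<le> 2 * R (n + 1) * (R (n + 1) - R n)"
    using zero_le_power2[of "R (n + 1) - R n"] by (simp add: power2_eq_square algebra_simps)
  moreover have "1 / 2 * (\<epsilon>\<^sup>2 - \<theta>\<^sup>2)
      * ((l2_norm \<Omega> (weak_grad \<Omega> ?w))\<^sup>2 - (l2_norm \<Omega> (weak_grad \<Omega> ?u))\<^sup>2)
    \<le> - \<epsilon>\<^sup>2 * ?ip (weak_laplacian \<Omega> ?w) d + \<theta>\<^sup>2 * ?ip (weak_laplacian \<Omega> ?u) d"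
    unfolding d_def
  proof (rule imex_gradient_estimate)
    show "?u \<in> H2 \<Omega>" "?w \<in> H2 \<Omega>"
      using n by (auto intro: H2)
    show "- ?ip (weak_laplacian \<Omega> p) q = ?ip (weak_grad \<Omega> p) (weak_grad \<Omega> q)"
      if "p \<in> {?u, ?w}" "q \<in> {?u, ?w}" for p q
      using that n by (auto intro!: green simp del: minus_minus)
  qed
  ultimately show "energy \<Omega> \<epsilon> \<theta> \<phi> R (n + 1) - energy \<Omega> \<epsilon> \<theta> \<phi> R n \<le> 0"
    unfolding energy_def by (simp add: right_diff_distrib)
qed

end
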